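(* Suppose that $H$ is a complete $\ell$-partite graph with $\ell\ge 3$ such that every vertex class of $H$, except possibly its smallest class, has at least $3$ vertices. Then there are infinitely many graphs $G$ whose order $n$ is divisible by $|H|$, whose minimum degree satisfies $\delta(G)=\left(1-\frac{1}{\chi_{cr}(H)}\right)n$, but which do not contain a perfect $H$-packing.
   Context: All graphs are finite and simple; $|H|$ denotes the order (number of vertices) of $H$. Given graphs $H$ and $G$, an $H$-packing in $G$ is a collection of vertex-disjoint copies of $H$ in $G$ (copies are not necessarily induced subgraphs); it is perfect if it covers all vertices of $G$. The critical chromatic number of a graph $H$ is $\chi_{cr}(H):=(\chi(H)-1)|H|/(|H|-\sigma(H))$, where $\chi(H)$ is the chromatic number and $\sigma(H)$ is the minimum size of the smallest colour class over all proper colourings of $H$ with $\chi(H)$ colours. (If several vertex classes of $H$ have minimum size, "the smallest class" means one of them; i.e. at least $\ell-1$ of the vertex classes have size at least $3$.) *)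

theory Defs
  imports
    Complex_Main
    "HOL-Library.Disjoint_Sets"
    "Graph_Theory.Pair_Digraph"
    "Graph_Theory.Digraph_Isomorphism"
begin

text \<open>
  Finite simple graphs are the graphs satisfying \<open>pair_graph\<close>: every undirected edge is represented
  by its two arcs.  Hence the degree of a vertex is its out-degree, and a subgraph that is
  isomorphic to a simple graph is itself simple.
\<close>

abbreviation graph_order :: "'a pair_pre_digraph \<Rightarrow> nat" where
  "graph_order G \<equiv> card (pverts G)"

definition min_degree :: "'a pair_pre_digraph \<Rightarrow> nat" where
  "min_degree G = Min (out_degree (with_proj G) ` pverts G)"

definition proper_colouring :: "'a pair_pre_digraph \<Rightarrow> nat \<Rightarrow> ('a \<Rightarrow> nat) \<Rightarrow> bool" where
  "proper_colouring G k c \<longleftrightarrow>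
     (\<forall>v\<in>pverts G. c v < k) \<and> (\<forall>(u, v)\<in>parcs G. c u \<noteq> c v)"

definition chromatic_number :: "'a pair_pre_digraph \<Rightarrow> nat" where
  "chromatic_number G = (LEAST k. \<exists>c. proper_colouring G k c)"

definition smallest_class_size :: "'a pair_pre_digraph \<Rightarrow> nat \<Rightarrow> ('a \<Rightarrow> nat) \<Rightarrow> nat" where
  "smallest_class_size G k c = Min ((\<lambda>i. card {v \<in> pverts G. c v = i}) ` {..<k})"

text \<open>
  A proper colouring with \<open>chromatic_number G\<close> colours uses every colour, so no empty class
  enters the minimum.
\<close>

definition colour_sigma :: "'a pair_pre_digraph \<Rightarrow> nat" where
  "colour_sigma G =
     Inf {smallest_class_size G (chromatic_number G) c | c.
            proper_colouring G (chromatic_number G) c}"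

definition critical_chromatic_number :: "'a pair_pre_digraph \<Rightarrow> real" where
  "critical_chromatic_number G =
     (real (chromatic_number G) - 1) * real (graph_order G)
       / (real (graph_order G) - real (colour_sigma G))"

definition complete_multipartite :: "'a pair_pre_digraph \<Rightarrow> 'a set set \<Rightarrow> bool" where
  "complete_multipartite G P \<longleftrightarrow>
     pair_graph G \<and> partition_on (pverts G) P \<and>
     parcs G = {(u, v). \<exists>A\<in>P. \<exists>B\<in>P. A \<noteq> B \<and> u \<in> A \<and> v \<in> B}"

definition is_copy_in ::
  "'a pair_pre_digraph \<Rightarrow> 'b pair_pre_digraph \<Rightarrow> 'b pair_pre_digraph \<Rightarrow> bool" where
  "is_copy_in H K G \<longleftrightarrow> subgraph (with_proj K) (with_proj G) \<and> digraph_iso (with_proj H) (with_proj K)"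

definition packing ::
  "'a pair_pre_digraph \<Rightarrow> 'b pair_pre_digraph \<Rightarrow> 'b pair_pre_digraph set \<Rightarrow> bool" where
  "packing H G \<K> \<longleftrightarrow> (\<forall>K\<in>\<K>. is_copy_in H K G) \<and> disjoint_family_on pverts \<K>"

definition perfect_packing ::
  "'a pair_pre_digraph \<Rightarrow> 'b pair_pre_digraph \<Rightarrow> 'b pair_pre_digraph set \<Rightarrow> bool" where
  "perfect_packing H G \<K> \<longleftrightarrow> packing H G \<K> \<and> (\<Union>K\<in>\<K>. pverts K) = pverts G"

end

theory Submission
  imports Defs
begin

text \<open>
  Write \<open>m = |H|\<close>, let \<open>\<sigma>\<close> be the size of the smallest class of \<open>H\<close>, fix \<open>k \<ge> 1\<close> and put
  \<open>s = k (m - \<sigma>)\<close>, so that \<open>n - s\<close> is the required minimum degree for \<open>n = k (l - 1) m\<close>.  Start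
  from the complete \<open>l\<close>-partite graph on \<open>n\<close> vertices with one class \<open>A\<close> of size \<open>s + 1\<close>, with
  \<open>l - 2\<close> classes of size \<open>s\<close> and a last class of size \<open>k (l - 1) \<sigma> - 1\<close>, and restore the degree
  missing in \<open>A\<close> by placing disjoint edges and triangles inside \<open>A\<close>.
  A copy of \<open>H\<close> that meets \<open>A\<close> in an independent set has its classes cut out by those of the host
  graph.  Otherwise it meets \<open>A\<close> in a set \<open>S\<close> inside one edge or triangle.  As \<open>|S| \<le> 3\<close>, only the smallest
  class of \<open>H\<close> can lie inside \<open>S\<close>, and by pigeonhole it does; then the last host class contains
  \<open>D - S\<close> for another class \<open>D\<close> of \<open>H\<close>, and \<open>|D - S| \<ge> 3 - (|S| - \<sigma>) \<ge> \<sigma>\<close>.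
  In either case the copy uses at least \<open>\<sigma>\<close> vertices of the last class, which is one vertex too
  small for the \<open>k (l - 1)\<close> copies of a perfect packing.
\<close>

section \<open>Colour classes against the classes of a multipartite graph\<close>

text \<open>On \<open>V\<close> the map \<open>p\<close> factors through \<open>c\<close>, so |I|
  \<le> |p \<open>V| \<le> |c\<close> V| \<le> |I|. Equality throughout makes the induced map from
  colours to classes injective. Thus a proper colouring with no more colours than classes has
  exactly the classes as its colour classes.\<close>

lemma fibres_eq_of_card_le:
  assumes "finite I" and "c ` V \<subseteq> I" and "card I \<le> card (p ` V)"
    and "\<And>u v. u \<in> V \<Longrightarrow> v \<in> V \<Longrightarrow> c u = c v \<Longrightarrow> p u = p v"
  shows "c ` V = I" and "card (p ` V) = card I"
    and "\<And>u v. u \<in> V \<Longrightarrow> v \<in> V \<Longrightarrow> p u = p v \<Longrightarrow> c u = c v"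
proof -
  define g where "g i = p (inv_into V c i)" for i
  have g: "g (c v) = p v" if "v \<in> V" for v
    unfolding g_def using that by (intro assms(4)) (auto intro: inv_into_into f_inv_into_f)
  have img: "g ` c ` V = p ` V"
    using g by (force simp: image_image)
  have fin: "finite (c ` V)"
    using assms(1,2) finite_subset by blast
  have le: "card (p ` V) \<le> card (c ` V)"
    using card_image_le[OF fin, of g] img by simp
  have "card (c ` V) \<le> card I"
    using assms(1,2) card_mono by blast
  then have eq: "card (c ` V) = card I" "card (p ` V) = card I"
    using le assms(3) by auto
  show "c ` V = I" using eq(1) assms(1,2) card_subset_eq by blast
  show "card (p ` V) = card I" by (fact eq(2))
  have "inj_on g (c ` V)"
    using fin eq img by (intro eq_card_imp_inj_on) auto
  then show "c u = c v" if "u \<in> V" "v \<in> V" "p u = p v" for u v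
    using inj_onD[of g "c ` V" "c u" "c v"] that g by simp
qed

text \<open>In the application \<open>p\<close> is the class of a vertex in H and \<open>c\<close>
  the host class of its image; \<open>conflict\<close> records that adjacent vertices sharing a host
  class lie in host class 0, which the copy then meets in at most three vertices.\<close>

lemma last_class_ge:
  fixes c :: "'a \<Rightarrow> nat"
  assumes fin: "finite V" and l: "card (p ` V) = l" "l \<ge> 2" and c: "c ` V \<subseteq> {..<l}"
    and C: "C \<in> p ` V"
    and min: "\<And>B. B \<in> p ` V \<Longrightarrow> card {v \<in> V. p v = C} \<le> card {v \<in> V. p v = B}"
    and three: "\<And>B. B \<in> p ` V \<Longrightarrow> B \<noteq> C \<Longrightarrow> 3 \<le> card {v \<in> V. p v = B}"
    and conflict: "\<And>u v. u \<in> V \<Longrightarrow> v \<in> V \<Longrightarrow> c u = c v \<Longrightarrow> p u \<noteq> p v \<Longrightarrow>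
           c u = 0 \<and> card {w \<in> V. c w = 0} \<le> 3"
  shows "card {v \<in> V. p v = C} \<le> card {v \<in> V. c v = l - 1}"
proof (cases "\<exists>u\<in>V. \<exists>v\<in>V. c u = c v \<and> p u \<noteq> p v")
  case False
  then have indep: "\<And>u v. u \<in> V \<Longrightarrow> v \<in> V \<Longrightarrow> c u = c v \<Longrightarrow> p u = p v" by blast
  note bij = fibres_eq_of_card_le[where p = p, OF _ c _ indep]
  have "c ` V = {..<l}" by (rule bij(1)) (use l in auto)
  moreover have "l - 1 \<in> {..<l}" using l(2) by simp
  ultimately obtain w where w: "w \<in> V" "c w = l - 1"
    by (metis (no_types, lifting) imageE)
  have "c v = c w" if "v \<in> V" "p v = p w" for v
    by (rule bij(3)) (use that w l in auto)
  then have "c v = c w \<longleftrightarrow> p v = p w" if "v \<in> V" for v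
    using indep[OF that w(1)] that by blast
  then have "{v \<in> V. c v = l - 1} = {v \<in> V. p v = p w}"
    using w(2) by auto
  then show ?thesis using min w by auto
next
  case True
  define S where "S = {w \<in> V. c w = 0}"
  obtain u v where uv: "u \<in> V" "v \<in> V" "c u = c v" "p u \<noteq> p v" using True by blast
  have S: "card S \<le> 3" "u \<in> S" "v \<in> S" "finite S"
    using conflict[OF uv] uv fin by (auto simp: S_def)
  \<comment> \<open>A class other than \<open>C\<close> inside \<open>S\<close> would have at least
    3 \<ge> |S| vertices and so equal \<open>S\<close>, but \<open>S\<close> contains
    \<open>u\<close> and \<open>v\<close> from different classes.\<close>
  have sub: "p ` V - {C} \<subseteq> p ` (V - S)"
  proof
    fix D assume D: "D \<in> p ` V - {C}"
    have "\<not> {x \<in> V. p x = D} \<subseteq> S"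
    proof
      assume *: "{x \<in> V. p x = D} \<subseteq> S"
      have "{x \<in> V. p x = D} = S"
        using D three[of D] S(1) by (intro card_subset_eq[OF S(4) *] antisym card_mono[OF S(4) *]) auto
      then have "u \<in> {x \<in> V. p x = D}" "v \<in> {x \<in> V. p x = D}" using S by simp_all
      then show False using uv(4) by simp
    qed
    then show "D \<in> p ` (V - S)" by blast
  qed
  have cardC: "card (p ` V - {C}) = l - 1"
    using C l fin by simp
  have cI: "c ` (V - S) \<subseteq> {1..<l}"
    using c by (auto simp: S_def image_subset_iff Suc_le_eq)
  have le: "card {1..<l} \<le> card (p ` (V - S))"
    using card_mono[OF _ sub] cardC fin by simp
  have indep: "p x = p y" if "x \<in> V - S" "y \<in> V - S" "c x = c y" for x y
    using conflict[OF _ _ that(3)] that by (cases "p x = p y") (auto simp: S_def)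
  note bij = fibres_eq_of_card_le[where p = p, OF finite_atLeastLessThan cI le]
  have "card (p ` (V - S)) = card {1..<l}" by (rule bij(2)) (rule indep)
  \<comment> \<open>Deleting \<open>S\<close> leaves l - 1 colours and at least l - 1 classes. The
    count forces exactly l - 1 classes, so every vertex of \<open>C\<close> lies in
    \<open>S\<close>.\<close>
  then have J: "p ` (V - S) = p ` V - {C}"
    using cardC fin by (intro card_subset_eq[OF _ sub, symmetric]) simp_all
  have "c ` (V - S) = {1..<l}" by (rule bij(1)) (rule indep)
  moreover have "l - 1 \<in> {1..<l}" using l(2) by auto
  ultimately obtain w where w: "w \<in> V - S" "c w = l - 1"
    by (metis (no_types, lifting) imageE)
  have D: "p w \<noteq> C" "p w \<in> p ` V" using J w by blast+
  let ?D = "{x \<in> V. p x = p w}" and ?C = "{x \<in> V. p x = C}"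
  have last: "{x \<in> V. c x = l - 1} = ?D - S"
  proof -
    have "c x = c w" if "x \<in> V - S" "p x = p w" for x
      by (rule bij(3)[OF _ that(1) w(1) that(2)]) (rule indep)
    then have "c x = l - 1 \<longleftrightarrow> p x = p w" if "x \<in> V - S" for x
      using indep[OF that w(1)] that w(2) by metis
    moreover have "c x \<noteq> l - 1" if "x \<in> S" for x
      using that l(2) by (auto simp: S_def)
    ultimately show ?thesis by auto
  qed
  have CS: "?C \<subseteq> S"
    using J by blast
  \<comment> \<open>\<open>?C\<close> and \<open>?D \<inter> S\<close> are disjoint parts of
    \<open>S\<close>, so their sizes add up to at most 3, hence to at most |D|.\<close>
  have "card ?C + card (?D \<inter> S) = card (?C \<union> (?D \<inter> S))"
    using D(1) fin by (intro card_Un_disjoint[symmetric]) auto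
  also have "\<dots> \<le> card S" using CS S(4) by (intro card_mono) auto
  finally have "card ?C + card (?D \<inter> S) \<le> 3" using S(1) by simp
  moreover have "card (?D - S) + card (?D \<inter> S) = card ?D"
    using fin by (subst card_Un_disjoint[symmetric]) (auto intro!: arg_cong[where f = card])
  ultimately show ?thesis using three[OF D(2,1)] last by simp
qed

section \<open>Blocks and vertex classes of prescribed sizes\<close>

text \<open>Pairs are split off until at most three elements remain. Size at least 2 gives each
  vertex an extra neighbour, size at most 3 limits what a copy of H gains from a block, and a
  triangle absorbs odd parity.\<close>

lemma ex_small_blocks:
  assumes "finite A" "card A \<ge> 2"
  shows "\<exists>b :: 'a \<Rightarrow> 'a. b ` A \<subseteq> A \<and> (\<forall>v\<in>A. card {w \<in> A. b w = b v} \<in> {2, 3})"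
  using assms
proof (induction "card A" arbitrary: A rule: less_induct)
  case less
  obtain x where x: "x \<in> A" using less.prems by fastforce
  show ?case
  proof (cases "card A \<le> 3")
    case True
    then show ?thesis using x less.prems by (intro exI[of _ "\<lambda>_. x"]) auto
  next
    case False
    obtain y where y: "y \<in> A" "y \<noteq> x"
      using less.prems x by (metis card_le_Suc0_iff_eq not_less_eq_eq numeral_2_eq_2)
    define A' where "A' = A - {x, y}"
    have "card A' = card A - 2" using x y by (simp add: A'_def card_Diff_subset)
    then have "card A' < card A" "card A' \<ge> 2" "finite A'"
      using less.prems False by (auto simp: A'_def)
    then obtain b where b: "b ` A' \<subseteq> A'" "\<forall>v\<in>A'. card {w \<in> A'. b w = b v} \<in> {2, 3}"
      using less.hyps[of A'] by blast
    \<comment> \<open>\<open>b\<close> takes its labels from \<open>A'\<close>, so the removed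
      vertex \<open>x\<close> is a fresh label for the block {x, y}.\<close>
    define b' where "b' v = (if v \<in> A' then b v else x)" for v
    have new: "{w \<in> A. b' w = x} = {x, y}"
      using b(1) x y by (auto simp: b'_def A'_def)
    have old: "{w \<in> A. b' w = b' v} = {w \<in> A'. b w = b v}" if "v \<in> A'" for v
      using b(1) that by (auto simp: b'_def A'_def)
    have "card {w \<in> A. b' w = b' v} \<in> {2, 3}" if "v \<in> A" for v
    proof (cases "v \<in> A'")
      case True then show ?thesis using old b(2) by simp
    next
      case False then show ?thesis using new y by (simp add: b'_def)
    qed
    moreover have "b' ` A \<subseteq> A" using b(1) x by (auto simp: b'_def A'_def)
    ultimately show ?thesis by blast
  qed
qed

lemma ex_fun_fibre_cards:
  fixes a :: "nat \<Rightarrow> nat"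
  shows "\<exists>f :: nat \<Rightarrow> nat. f ` {..<sum a {..<l}} \<subseteq> {..<l} \<and>
           (\<forall>i<l. card {v \<in> {..<sum a {..<l}}. f v = i} = a i)"
proof (induction l)
  case 0 show ?case by simp
next
  case (Suc l)
  define N where "N = sum a {..<l}"
  obtain f :: "nat \<Rightarrow> nat" where f: "f ` {..<N} \<subseteq> {..<l}" "\<forall>i<l. card {v \<in> {..<N}. f v = i} = a i"
    using Suc.IH unfolding N_def by blast
  define g where "g v = (if v < N then f v else l)" for v
  have eq: "{v \<in> {..<N + a l}. g v = i} = (if i = l then {N..<N + a l} else {v \<in> {..<N}. f v = i})" for i
    using f(1) by (auto simp: g_def image_subset_iff split: if_splits)
  have "g ` {..<N + a l} \<subseteq> {..<Suc l}"
    using f(1) by (auto simp: g_def image_subset_iff less_Suc_eq)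
  moreover have "\<forall>i<Suc l. card {v \<in> {..<N + a l}. g v = i} = a i"
    unfolding eq using f(2) by (auto simp: less_Suc_eq)
  ultimately show ?case by (intro exI[of _ g]) (simp add: N_def)
qed

section \<open>Degrees, copies and complete multipartite graphs\<close>

lemma out_degree_eq_card_neighbours:
  "out_degree (with_proj G) v = card {w. (v, w) \<in> parcs G}"
proof -
  have "out_arcs (with_proj G) v = Pair v ` {w. (v, w) \<in> parcs G}"
    by (auto simp: out_arcs_def)
  then show ?thesis by (simp add: out_degree_def card_image inj_on_def)
qed

lemma digraph_iso_order:
  assumes "digraph_iso (with_proj G) (with_proj K)"
  shows "graph_order K = graph_order G"
proof -
  obtain h where h: "pre_digraph.digraph_isomorphism (with_proj G) h"
      "with_proj K = app_iso h (with_proj G)"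
    using assms by (auto simp: digraph_iso_def)
  have "pverts K = iso_verts h ` pverts G"
    using arg_cong[OF h(2), of verts] by simp
  moreover have "inj_on (iso_verts h) (pverts G)"
    using h(1) by (simp add: pre_digraph.digraph_isomorphism_def)
  ultimately show ?thesis by (simp add: card_image)
qed

lemma is_copy_inE:
  assumes "is_copy_in H K G"
  obtains \<phi> where "bij_betw \<phi> (pverts H) (pverts K)" and "pverts K \<subseteq> pverts G"
    and "\<And>u v. (u, v) \<in> parcs H \<Longrightarrow> (\<phi> u, \<phi> v) \<in> parcs G"
proof -
  obtain h where h: "pre_digraph.digraph_isomorphism (with_proj H) h"
      "with_proj K = app_iso h (with_proj H)"
    using assms by (auto simp: is_copy_in_def digraph_iso_def)
  have sub: "pverts K \<subseteq> pverts G" "parcs K \<subseteq> parcs G"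
    using assms by (auto simp: is_copy_in_def subgraph_def)
  have V: "pverts K = iso_verts h ` pverts H"
    using arg_cong[OF h(2), of verts] by simp
  have A: "parcs K = iso_arcs h ` parcs H"
    using arg_cong[OF h(2), of arcs] by simp
  \<comment> \<open>The copy has the projections as tail and head, so \<open>h\<close> must carry
    arcs coordinatewise by its vertex map.\<close>
  have T: "iso_tail h = fst" "iso_head h = snd"
    using arg_cong[OF h(2), of tail] arg_cong[OF h(2), of head] by simp_all
  have "(iso_verts h u, iso_verts h v) \<in> parcs G" if "(u, v) \<in> parcs H" for u v
  proof -
    have "iso_arcs h (u, v) = (iso_verts h u, iso_verts h v)"
      using h(1) that T by (force simp: pre_digraph.digraph_isomorphism_def prod_eq_iff)
    then show ?thesis using A sub(2) that by force
  qed
  moreover have "bij_betw (iso_verts h) (pverts H) (pverts K)"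
    using h(1) V by (simp add: pre_digraph.digraph_isomorphism_def bij_betw_def)
  ultimately show thesis using that sub(1) by blast
qed

text \<open>Trades the partition for a function sending each vertex to its class, so that classes
  become fibres and can be compared with those of a colouring.\<close>

lemma complete_multipartiteE:
  assumes "complete_multipartite H P"
  obtains p where "finite (pverts H)" and "p ` pverts H = P"
    and "\<forall>B\<in>P. {v \<in> pverts H. p v = B} = B"
    and "parcs H = {(u, v). u \<in> pverts H \<and> v \<in> pverts H \<and> p u \<noteq> p v}"
proof -
  have P: "partition_on (pverts H) P"
    and arcs: "parcs H = {(u, v). \<exists>A\<in>P. \<exists>B\<in>P. A \<noteq> B \<and> u \<in> A \<and> v \<in> B}"
    and fin: "finite (pverts H)"
    using assms pair_fin_digraph.pair_finite_verts
    by (auto simp: complete_multipartite_def pair_graph_def pair_digraph_def)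
  have "\<forall>v\<in>pverts H. \<exists>B. B \<in> P \<and> v \<in> B"
    using P by (auto simp: partition_on_def)
  then obtain p where p: "\<forall>v\<in>pverts H. p v \<in> P \<and> v \<in> p v" by metis
  have sub: "B \<subseteq> pverts H" and ne: "B \<noteq> {}" if "B \<in> P" for B
    using P that by (auto simp: partition_on_def)
  have uniq: "p v = B" if "B \<in> P" "v \<in> B" for v B
  proof (rule ccontr)
    assume "p v \<noteq> B"
    moreover have "v \<in> pverts H" using sub that by blast
    ultimately show False
      using partition_onD2[OF P] p that by (auto simp: disjoint_def)
  qed
  have mem: "v \<in> B \<longleftrightarrow> v \<in> pverts H \<and> p v = B" if "B \<in> P" for v B
    using that p sub uniq by blast
  show thesis
  proof (rule that[OF fin])
    show "p ` pverts H = P"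
    proof
      show "p ` pverts H \<subseteq> P" using p by blast
      show "P \<subseteq> p ` pverts H"
      proof
        fix B assume "B \<in> P"
        then obtain v where "v \<in> B" using ne by blast
        then show "B \<in> p ` pverts H" using mem[OF \<open>B \<in> P\<close>, of v] by blast
      qed
    qed
    show "\<forall>B\<in>P. {v \<in> pverts H. p v = B} = B"
      using mem by blast
    show "parcs H = {(u, v). u \<in> pverts H \<and> v \<in> pverts H \<and> p u \<noteq> p v}"
      unfolding arcs using p by (auto simp: mem)
  qed
qed

text \<open>Equally coloured vertices lie in one class, so \<open>fibres_eq_of_card_le\<close>
  applies: fewer colours than classes are impossible, and with equally many the colour classes are
  the classes of H. Hence all optimal colourings have the same smallest class size.\<close>

lemma complete_multipartite_colouring:
  assumes fin: "finite (pverts H)"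
    and arcs: "parcs H = {(u, v). u \<in> pverts H \<and> v \<in> pverts H \<and> p u \<noteq> p v}"
  shows "chromatic_number H = card (p ` pverts H)" (is "_ = ?l")
    and "\<And>C. C \<in> p ` pverts H \<Longrightarrow>
          (\<And>B. B \<in> p ` pverts H \<Longrightarrow> card {v \<in> pverts H. p v = C} \<le> card {v \<in> pverts H. p v = B}) \<Longrightarrow>
          colour_sigma H = card {v \<in> pverts H. p v = C}"
proof -
  let ?V = "pverts H"
  have colouring: "proper_colouring H k c \<longleftrightarrow>
      c ` ?V \<subseteq> {..<k} \<and> (\<forall>u\<in>?V. \<forall>v\<in>?V. c u = c v \<longrightarrow> p u = p v)" for k c
    unfolding proper_colouring_def arcs by auto
  obtain h where h: "bij_betw h (p ` ?V) {..<?l}"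
    using ex_bij_betw_finite_nat[of "p ` ?V"] fin by (auto simp: lessThan_atLeast0)
  have range: "c ` ?V \<subseteq> {..<k}"
    and indep: "\<And>u v. u \<in> ?V \<Longrightarrow> v \<in> ?V \<Longrightarrow> c u = c v \<Longrightarrow> p u = p v"
    if "proper_colouring H k c" for k c
    using that unfolding colouring by blast+
  have ex: "proper_colouring H ?l (h \<circ> p)"
    using h by (auto simp: colouring bij_betw_def inj_on_def)
  have "?l \<le> k" if "proper_colouring H k c" for k c
  proof (rule ccontr)
    assume "\<not> ?l \<le> k"
    then have "card (p ` ?V) = card {..<k}"
      by (intro fibres_eq_of_card_le(2)[where p = p, OF _ range[OF that] _ indep[OF that]]) auto
    then show False using \<open>\<not> ?l \<le> k\<close> by simp
  qed
  then show chi: "chromatic_number H = ?l"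
    unfolding chromatic_number_def using ex by (intro Least_equality) auto
  fix C assume C: "C \<in> p ` ?V"
    and min: "\<And>B. B \<in> p ` ?V \<Longrightarrow> card {v \<in> ?V. p v = C} \<le> card {v \<in> ?V. p v = B}"
  have "smallest_class_size H ?l c = card {v \<in> ?V. p v = C}" if c: "proper_colouring H ?l c" for c
  proof -
    note bij = fibres_eq_of_card_le[where p = p, OF _ range[OF c] _ indep[OF c]]
    have img: "c ` ?V = {..<?l}" by (rule bij(1)) auto
    have "c u = c v" if "u \<in> ?V" "v \<in> ?V" "p u = p v" for u v
      by (rule bij(3)) (use that in auto)
    then have eq: "{v \<in> ?V. c v = c u} = {v \<in> ?V. p v = p u}" if "u \<in> ?V" for u
      using indep[OF c] that by blast
    have "(\<lambda>i. card {v \<in> ?V. c v = i}) ` {..<?l} = (\<lambda>B. card {v \<in> ?V. p v = B}) ` p ` ?V"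
      unfolding img[symmetric] image_image using eq by (intro image_cong) auto
    then show ?thesis
      unfolding smallest_class_size_def using C min fin by (auto intro!: Min_eqI)
  qed
  \<comment> \<open>By \<open>ex\<close> the set is nonempty, so the infimum is taken over a
    singleton.\<close>
  then have "{smallest_class_size H ?l c | c. proper_colouring H ?l c} = {card {v \<in> ?V. p v = C}}"
    using ex by force
  then show "colour_sigma H = card {v \<in> ?V. p v = C}"
    by (simp add: colour_sigma_def chi)
qed

section \<open>The host graph and the copies of H in it\<close>

text \<open>\<open>f\<close> gives the class of a vertex, and \<open>b\<close> its block, which matters only within class \<open>0\<close>.\<close>

definition layered_graph :: "nat \<Rightarrow> (nat \<Rightarrow> nat) \<Rightarrow> (nat \<Rightarrow> nat) \<Rightarrow> nat pair_pre_digraph" where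
  "layered_graph n f b = \<lparr>pverts = {..<n}, parcs = {(u, v). u < n \<and> v < n \<and>
     (f u \<noteq> f v \<or> (f u = 0 \<and> u \<noteq> v \<and> b u = b v))}\<rparr>"

lemma pair_graph_layered_graph: "pair_graph (layered_graph n f b)"
proof unfold_locales
  show "finite (parcs (layered_graph n f b))"
    by (rule finite_subset[of _ "{..<n} \<times> {..<n}"]) (auto simp: layered_graph_def)
  show "symmetric (with_proj (layered_graph n f b))"
    by (auto simp: symmetric_def layered_graph_def intro!: symI)
qed (auto simp: layered_graph_def)

text \<open>A vertex outside class 0 misses exactly its own class. Class 0 may be one vertex too
  large, but a partner in the same block restores the lost degree; \<open>z\<close> attains the
  bound.\<close>

lemma min_degree_layered_graph:
  assumes zero: "card {v \<in> {..<n}. f v = 0} \<le> s + 1"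
    and pos: "\<And>i. i \<noteq> 0 \<Longrightarrow> card {v \<in> {..<n}. f v = i} \<le> s"
    and z: "z < n" "f z \<noteq> 0" "card {v \<in> {..<n}. f v = f z} = s"
    and blocks: "\<And>v. v < n \<Longrightarrow> f v = 0 \<Longrightarrow> \<exists>w<n. w \<noteq> v \<and> f w = 0 \<and> b w = b v"
  shows "min_degree (layered_graph n f b) = n - s"
proof -
  let ?G = "layered_graph n f b"
  let ?F = "\<lambda>v. {w \<in> {..<n}. f w = f v}"
  have deg: "out_degree (with_proj ?G) v = card {w. (v, w) \<in> parcs ?G}" for v
    by (rule out_degree_eq_card_neighbours)
  have nonzero: "out_degree (with_proj ?G) v = n - card (?F v)" if "v < n" "f v \<noteq> 0" for v
  proof -
    have "{w. (v, w) \<in> parcs ?G} = {..<n} - ?F v"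
      using that by (auto simp: layered_graph_def)
    moreover have "card ({..<n} - ?F v) = n - card (?F v)"
      by (subst card_Diff_subset) auto
    ultimately show ?thesis unfolding deg by simp
  qed
  have "n - s \<le> out_degree (with_proj ?G) v" if v: "v < n" for v
  proof (cases "f v = 0")
    case False
    then show ?thesis using pos[of "f v"] nonzero[OF v] by simp
  next
    case True
    then obtain w where w: "w < n" "w \<noteq> v" "f w = 0" "b w = b v" using blocks v by blast
    have fin: "finite {w. (v, w) \<in> parcs ?G}"
      by (rule finite_subset[of _ "{..<n}"]) (auto simp: layered_graph_def)
    have "n - (s + 1) \<le> card ({..<n} - ?F v)"
      using zero True by (subst card_Diff_subset) auto
    moreover have "n > 0" using v by simp
    moreover have "card (insert w ({..<n} - ?F v)) = Suc (card ({..<n} - ?F v))"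
      using w True by (intro card_insert_disjoint) auto
    moreover have "card (insert w ({..<n} - ?F v)) \<le> card {w. (v, w) \<in> parcs ?G}"
      using w v True by (intro card_mono[OF fin]) (auto simp: layered_graph_def)
    ultimately show ?thesis unfolding deg by linarith
  qed
  moreover have "out_degree (with_proj ?G) z = n - s" using nonzero z by simp
  moreover have "pverts ?G = {..<n}" by (simp add: layered_graph_def)
  ultimately show ?thesis
    unfolding min_degree_def using z(1) by (intro Min_eqI) (auto intro: rev_image_eqI)
qed

lemma copy_in_layered_graph:
  assumes copy: "is_copy_in H K (layered_graph n f b)"
    and fin: "finite (pverts H)"
    and arcs: "parcs H = {(u, v). u \<in> pverts H \<and> v \<in> pverts H \<and> p u \<noteq> p v}"
    and l: "card (p ` pverts H) = l" "l \<ge> 2"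
    and C: "C \<in> p ` pverts H"
    and min: "\<And>B. B \<in> p ` pverts H \<Longrightarrow> card {v \<in> pverts H. p v = C} \<le> card {v \<in> pverts H. p v = B}"
    and three: "\<And>B. B \<in> p ` pverts H \<Longrightarrow> B \<noteq> C \<Longrightarrow> 3 \<le> card {v \<in> pverts H. p v = B}"
    and f: "f ` {..<n} \<subseteq> {..<l}"
    and blocks: "\<forall>v<n. f v = 0 \<longrightarrow> card {w \<in> {..<n}. f w = 0 \<and> b w = b v} \<le> 3"
  shows "card {v \<in> pverts H. p v = C} \<le> card {v \<in> pverts K. f v = l - 1}"
proof -
  let ?V = "pverts H"
  obtain \<phi> where \<phi>: "bij_betw \<phi> ?V (pverts K)" "pverts K \<subseteq> pverts (layered_graph n f b)"
      "\<And>u v. (u, v) \<in> parcs H \<Longrightarrow> (\<phi> u, \<phi> v) \<in> parcs (layered_graph n f b)"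
    using is_copy_inE[OF copy] by metis
  have lt: "\<phi> v < n" if "v \<in> ?V" for v
    using \<phi>(1,2) that by (auto simp: layered_graph_def bij_betw_def)
  have edge: "f (\<phi> u) \<noteq> f (\<phi> v) \<or> (f (\<phi> u) = 0 \<and> b (\<phi> u) = b (\<phi> v))"
    if "u \<in> ?V" "v \<in> ?V" "p u \<noteq> p v" for u v
    using \<phi>(3)[of u v] that by (auto simp: arcs layered_graph_def)
  have "card {v \<in> ?V. p v = C} \<le> card {v \<in> ?V. (f \<circ> \<phi>) v = l - 1}"
  proof (rule last_class_ge[OF fin l _ C min three])
    show "(f \<circ> \<phi>) ` ?V \<subseteq> {..<l}" using f lt by auto
    fix u v assume uv: "u \<in> ?V" "v \<in> ?V" "(f \<circ> \<phi>) u = (f \<circ> \<phi>) v" "p u \<noteq> p v"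
    have *: "f (\<phi> u) = 0" "b (\<phi> u) = b (\<phi> v)" "f (\<phi> v) = 0" using edge[of u v] uv by auto
    \<comment> \<open>As \<open>u\<close> and \<open>v\<close> have different classes in H,
      \<open>w\<close> is adjacent to at least one of them; hence all vertices of the copy in host
      class 0 share one block.\<close>
    have "b (\<phi> w) = b (\<phi> u)" if "w \<in> ?V" "f (\<phi> w) = 0" for w
      using edge[of w u] edge[of w v] * uv that by (cases "p w = p u") auto
    then have "\<phi> ` {w \<in> ?V. f (\<phi> w) = 0} \<subseteq> {x \<in> {..<n}. f x = 0 \<and> b x = b (\<phi> u)}"
      using lt by auto
    from card_mono[OF _ this] have "card (\<phi> ` {w \<in> ?V. f (\<phi> w) = 0}) \<le> 3"
      using blocks[rule_format, of "\<phi> u"] lt uv * by simp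
    moreover have "inj_on \<phi> {w \<in> ?V. f (\<phi> w) = 0}"
      using \<phi>(1) by (auto simp: bij_betw_def inj_on_def)
    ultimately show "(f \<circ> \<phi>) u = 0 \<and> card {w \<in> ?V. (f \<circ> \<phi>) w = 0} \<le> 3"
      using * by (simp add: card_image)
  qed
  also have "\<dots> = card (\<phi> ` {v \<in> ?V. (f \<circ> \<phi>) v = l - 1})"
    using \<phi>(1) by (intro card_image[symmetric]) (auto simp: bij_betw_def inj_on_def)
  also have "\<phi> ` {v \<in> ?V. (f \<circ> \<phi>) v = l - 1} = {v \<in> pverts K. f v = l - 1}"
    using \<phi>(1) by (auto simp: bij_betw_def)
  finally show ?thesis .
qed

text \<open>The copies are disjoint and all have |H| vertices, so a perfect packing has exactly
  \<open>q\<close> members, and their shares of \<open>A\<close> add up.\<close>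

lemma perfect_packing_counting:
  assumes pp: "perfect_packing H G \<K>" and fin: "finite (pverts G)"
    and ne: "pverts H \<noteq> {}" "finite (pverts H)"
    and order: "graph_order G = q * graph_order H"
    and ge: "\<And>K. is_copy_in H K G \<Longrightarrow> \<sigma> \<le> card (pverts K \<inter> A)"
  shows "q * \<sigma> \<le> card (pverts G \<inter> A)"
proof -
  have copy: "is_copy_in H K G" if "K \<in> \<K>" for K
    using pp that by (auto simp: perfect_packing_def packing_def)
  have ord: "card (pverts K) = graph_order H" if "K \<in> \<K>" for K
    using copy[OF that] digraph_iso_order by (auto simp: is_copy_in_def)
  have disj: "pverts K \<inter> pverts L = {}" if "K \<in> \<K>" "L \<in> \<K>" "K \<noteq> L" for K L
    using pp that by (auto simp: perfect_packing_def packing_def disjoint_family_on_def)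
  have cover: "(\<Union>K\<in>\<K>. pverts K) = pverts G"
    using pp by (simp add: perfect_packing_def)
  have pos: "card (pverts H) > 0" using ne by (simp add: card_gt_0_iff)
  have finK: "finite (pverts K)" if "K \<in> \<K>" for K
    using ord[OF that] pos card_gt_0_iff by fastforce
  \<comment> \<open>Distinct members have disjoint nonempty vertex sets. The packing thus injects
    into the power set of the vertices of \<open>G\<close> and is finite.\<close>
  have "inj_on pverts \<K>"
  proof (rule inj_onI, rule ccontr)
    fix K L assume "K \<in> \<K>" "L \<in> \<K>" "pverts K = pverts L" "K \<noteq> L"
    then show False using disj[of K L] ord[of K] pos by auto
  qed
  moreover have "pverts ` \<K> \<subseteq> Pow (pverts G)" using cover by auto
  ultimately have fin\<K>: "finite \<K>"
    using fin by (metis finite_Pow_iff finite_imageD finite_subset)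
  have "card (pverts G) = (\<Sum>K\<in>\<K>. card (pverts K))"
    unfolding cover[symmetric] using fin\<K> finK disj by (intro card_UN_disjoint) auto
  also have "\<dots> = (\<Sum>K\<in>\<K>. graph_order H)" using ord by (intro sum.cong) auto
  finally have "q * graph_order H = card \<K> * graph_order H" using order by simp
  then have "q * \<sigma> = (\<Sum>K\<in>\<K>. \<sigma>)" using pos by simp
  also have "\<dots> \<le> (\<Sum>K\<in>\<K>. card (pverts K \<inter> A))"
    using copy ge by (intro sum_mono) auto
  also have "\<dots> = card (\<Union>K\<in>\<K>. pverts K \<inter> A)"
    using fin\<K> finK disj by (intro card_UN_disjoint[symmetric]) auto
  also have "(\<Union>K\<in>\<K>. pverts K \<inter> A) = pverts G \<inter> A" using cover by auto
  finally show ?thesis .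
qed

lemma ex_layered_graph:
  assumes s: "s \<ge> 1" and t: "t \<le> s" and l: "l \<ge> 3" and n: "n = (l - 1) * s + 1 + t"
  obtains f b where "f ` {..<n} \<subseteq> {..<l}"
    and "card {v \<in> {..<n}. f v = l - 1} = t"
    and "min_degree (layered_graph n f b) = n - s"
    and "\<forall>v<n. f v = 0 \<longrightarrow> card {w \<in> {..<n}. f w = 0 \<and> b w = b v} \<le> 3"
proof -
  \<comment> \<open>The sizes add up to (s + 1) + (l - 2) s + t = n.\<close>
  define a where "a i = (if i = 0 then s + 1 else if i < l - 1 then s else t)" for i :: nat
  obtain r where r: "l = Suc (Suc (Suc r))"
    using that[of "l - 3"] l by simp
  have "sum a {..<l} = s + 1 + (\<Sum>i<Suc r. s) + t"
    unfolding r sum.lessThan_Suc[of a "Suc (Suc r)"] sum.lessThan_Suc_shift[of a "Suc r"]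
    by (simp add: a_def r)
  then have sum: "sum a {..<l} = n"
    by (simp add: n r)
  obtain f :: "nat \<Rightarrow> nat" where f: "f ` {..<n} \<subseteq> {..<l}" "\<forall>i<l. card {v \<in> {..<n}. f v = i} = a i"
    using ex_fun_fibre_cards[of a l] unfolding sum by blast
  define A where "A = {v \<in> {..<n}. f v = 0}"
  have "card A = s + 1" using f(2) l by (simp add: A_def a_def)
  then have "finite A" "card A \<ge> 2" using s by (auto simp: A_def)
  from ex_small_blocks[OF this] obtain b where "b ` A \<subseteq> A"
    and b: "\<forall>v\<in>A. card {w \<in> A. b w = b v} \<in> {2, 3}" by (elim exE conjE)
  \<comment> \<open>As l \<ge> 3, class 1 is neither the enlarged class 0 nor the last class. It has
    exactly \<open>s\<close> vertices, so any of them attains degree n - s.\<close>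
  have "card {v \<in> {..<n}. f v = 1} = s"
    using f(2)[rule_format, of 1] r by (simp add: a_def)
  moreover from this s have "card {v \<in> {..<n}. f v = 1} \<noteq> 0" by linarith
  then have "{v \<in> {..<n}. f v = 1} \<noteq> {}" by (metis card.empty)
  ultimately obtain z where z: "z < n" "f z = 1" "card {v \<in> {..<n}. f v = f z} = s"
    by auto
  have "min_degree (layered_graph n f b) = n - s"
  proof (rule min_degree_layered_graph)
    show "card {v \<in> {..<n}. f v = 0} \<le> s + 1" using \<open>card A = s + 1\<close> by (simp add: A_def)
    show "card {v \<in> {..<n}. f v = i} \<le> s" if "i \<noteq> 0" for i
    proof (cases "i < l")
      case True then show ?thesis using f(2) that t by (simp add: a_def)
    next
      case False
      then have "{v \<in> {..<n}. f v = i} = {}" using f(1) by auto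
      then show ?thesis by (simp only: card.empty le0)
    qed
    show "z < n" "f z \<noteq> 0" "card {v \<in> {..<n}. f v = f z} = s" using z by auto
    fix v assume "v < n" "f v = 0"
    then have v: "v \<in> A" by (simp add: A_def)
    show "\<exists>w<n. w \<noteq> v \<and> f w = 0 \<and> b w = b v"
    proof (rule ccontr)
      assume "\<not> ?thesis"
      then have "{w \<in> A. b w = b v} = {v}" using v by (auto simp: A_def)
      then show False using b v by auto
    qed
  qed
  moreover have "card {w \<in> {..<n}. f w = 0 \<and> b w = b v} \<le> 3" if "v < n" "f v = 0" for v
  proof -
    have "{w \<in> {..<n}. f w = 0 \<and> b w = b v} = {w \<in> A. b w = b v}" "v \<in> A"
      using that by (auto simp: A_def)
    then show ?thesis using b by auto
  qed
  moreover have "card {v \<in> {..<n}. f v = l - 1} = t" using f(2) l by (simp add: a_def)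
  ultimately show thesis using that[of f b] f(1) by blast
qed

section \<open>The infinite family of host graphs\<close>

theorem proposition4:
  fixes H :: "'a pair_pre_digraph" and P :: "'a set set" and C :: "'a set" and l :: nat
  assumes "complete_multipartite H P"
    and "card P = l" and "l \<ge> 3"
    and "C \<in> P" and "\<And>B. B \<in> P \<Longrightarrow> card C \<le> card B"
    and "\<And>B. B \<in> P - {C} \<Longrightarrow> card B \<ge> 3"
  shows "\<exists>\<G> :: nat pair_pre_digraph set.
           infinite \<G> \<and>
           (\<forall>G\<in>\<G>. \<forall>G'\<in>\<G>. G \<noteq> G' \<longrightarrow> \<not> digraph_iso (with_proj G) (with_proj G')) \<and>
           (\<forall>G\<in>\<G>. pair_graph G \<and>
              graph_order H dvd graph_order G \<and>
              real (min_degree G) =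
                (1 - 1 / critical_chromatic_number H) * real (graph_order G) \<and>
              \<not> (\<exists>\<K>. perfect_packing H G \<K>))"
proof -
  let ?V = "pverts H"
  obtain p where fin: "finite ?V" and P: "p ` ?V = P"
    and part: "\<forall>B\<in>P. {v \<in> ?V. p v = B} = B"
    and arcs: "parcs H = {(u, v). u \<in> ?V \<and> v \<in> ?V \<and> p u \<noteq> p v}"
    by (rule complete_multipartiteE[OF assms(1)])
  define m where "m = card ?V"
  define \<sigma> where "\<sigma> = card C"
  have cardP: "card (p ` ?V) = l" and CP: "C \<in> p ` ?V" using P assms by auto
  have min: "card {v \<in> ?V. p v = C} \<le> card {v \<in> ?V. p v = B}" if "B \<in> p ` ?V" for B
    using that assms(4,5) part P by simp
  have three: "3 \<le> card {v \<in> ?V. p v = B}" if "B \<in> p ` ?V" "B \<noteq> C" for B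
    using that assms(6) part P by simp
  have chi: "chromatic_number H = l" and sig: "colour_sigma H = \<sigma>"
    using complete_multipartite_colouring[OF fin arcs] cardP CP min part assms(4)
    by (auto simp: \<sigma>_def)
  have "C \<noteq> {}" "C \<subseteq> ?V"
    using assms(1,4) by (auto simp: complete_multipartite_def partition_on_def)
  then have \<sigma>: "\<sigma> \<ge> 1"
    using fin by (metis One_nat_def Suc_leI \<sigma>_def card_gt_0_iff finite_subset)
  have "m = (\<Sum>B\<in>P. card {v \<in> ?V. p v = B})"
    using sum.image_gen[OF fin, of "\<lambda>_. 1 :: nat" p] P by (simp add: m_def)
  then have m: "l * \<sigma> \<le> m"
    using sum_mono[of P "\<lambda>_. \<sigma>" "\<lambda>B. card {v \<in> ?V. p v = B}"] min P part assms(2,4)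
    by (simp add: \<sigma>_def)
  have "\<sigma> * 3 \<le> l * \<sigma>" using assms(3) by simp
  then have lt: "\<sigma> < m" using m \<sigma> by linarith
  \<comment> \<open>The order n divided by the critical chromatic number is n (m - \<sigma>) / ((l -
    1) m); the factor l - 1 in n makes this the integer k (m - \<sigma>).\<close>
  have main: "\<exists>G :: nat pair_pre_digraph. pair_graph G \<and> graph_order G = k * (l - 1) * m \<and>
      min_degree G = k * (l - 1) * m - k * (m - \<sigma>) \<and> \<not> (\<exists>\<K>. perfect_packing H G \<K>)"
    if k: "k \<ge> 1" for k
  proof -
    define s where "s = k * (m - \<sigma>)"
    define t where "t = k * (l - 1) * \<sigma> - 1"
    define n where "n = k * (l - 1) * m"
    \<comment> \<open>The truncated subtraction in \<open>t\<close> is therefore exact: t + 1 = k (l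
      - 1) \<sigma>.\<close>
    have pos: "k * (l - 1) * \<sigma> \<ge> 1" using k \<sigma> assms(3) by simp
    \<comment> \<open>Since \<open>C\<close> is a smallest class, l \<sigma> \<le> m; hence the last
      host class has at most \<open>s\<close> vertices and does not lower the minimum
      degree.\<close>
    have "(l - 1) * \<sigma> \<le> m - \<sigma>" using m by (simp add: diff_mult_distrib)
    then have t: "t \<le> s"
      unfolding s_def t_def by (metis diff_le_self le_trans mult.assoc mult_le_mono2)
    have s: "s \<ge> 1" using k lt by (simp add: s_def)
    have "m = (m - \<sigma>) + \<sigma>" using lt by simp
    then have "k * (l - 1) * m = k * (l - 1) * (m - \<sigma>) + k * (l - 1) * \<sigma>"
      by (metis distrib_left)
    then have "n = (l - 1) * s + k * (l - 1) * \<sigma>"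
      by (simp add: n_def s_def mult_ac)
    then have n: "n = (l - 1) * s + 1 + t" using pos unfolding t_def by linarith
    obtain f b where f: "f ` {..<n} \<subseteq> {..<l}" "card {v \<in> {..<n}. f v = l - 1} = t"
        "min_degree (layered_graph n f b) = n - s"
        "\<forall>v<n. f v = 0 \<longrightarrow> card {w \<in> {..<n}. f w = 0 \<and> b w = b v} \<le> 3"
      by (rule ex_layered_graph[OF s t assms(3) n])
    let ?G = "layered_graph n f b"
    have V: "pverts ?G = {..<n}" by (simp add: layered_graph_def)
    have "\<not> perfect_packing H ?G \<K>" for \<K>
    proof
      assume pp: "perfect_packing H ?G \<K>"
      have "k * (l - 1) * \<sigma> \<le> card (pverts ?G \<inter> {v. f v = l - 1})"
      proof (rule perfect_packing_counting[OF pp])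
        show "?V \<noteq> {}" using CP by auto
        show "graph_order ?G = k * (l - 1) * graph_order H" using V by (simp add: n_def m_def)
        fix K assume "is_copy_in H K ?G"
        from copy_in_layered_graph[OF this fin arcs cardP _ CP min three f(1,4)]
        show "\<sigma> \<le> card (pverts K \<inter> {v. f v = l - 1})"
          using part assms(3,4) by (simp add: \<sigma>_def Int_def)
      qed (use V fin in auto)
      also have "pverts ?G \<inter> {v. f v = l - 1} = {v \<in> {..<n}. f v = l - 1}" using V by auto
      finally show False using f(2) pos unfolding t_def by linarith
    qed
    then show ?thesis
      using pair_graph_layered_graph[of n f b] f(3) V
      by (intro exI[of _ ?G]) (simp add: n_def s_def)
  qed
  then obtain G :: "nat \<Rightarrow> nat pair_pre_digraph" where G: "\<And>k. k \<ge> 1 \<Longrightarrow> pair_graph (G k) \<and>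
      graph_order (G k) = k * (l - 1) * m \<and>
      min_degree (G k) = k * (l - 1) * m - k * (m - \<sigma>) \<and> \<not> (\<exists>\<K>. perfect_packing H (G k) \<K>)"
    by metis
  \<comment> \<open>The order grows strictly with k, which makes the family infinite and its members
    pairwise nonisomorphic.\<close>
  have inj: "j = k" if "j \<ge> 1" "k \<ge> 1" "graph_order (G j) = graph_order (G k)" for j k
    using that G lt assms(3) by simp
  show ?thesis
  proof (intro exI[of _ "G ` {1..}"] conjI ballI impI)
    show "infinite (G ` {1..})"
      using inj by (subst finite_image_iff) (auto simp: inj_on_def infinite_Ici)
  next
    fix A B assume "A \<in> G ` {1..}" "B \<in> G ` {1..}" "A \<noteq> B"
    then show "\<not> digraph_iso (with_proj A) (with_proj B)"
      using inj digraph_iso_order by fastforce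
  next
    fix A assume "A \<in> G ` {1..}"
    then obtain k where k: "k \<ge> 1" and A: "A = G k" by auto
    note Gk = G[OF k]
    show "pair_graph A" "\<not> (\<exists>\<K>. perfect_packing H A \<K>)" using Gk A by auto
    show "graph_order H dvd graph_order A" using Gk A by (simp add: m_def)
    \<comment> \<open>Bounding the subtrahend makes the natural-number subtraction in the minimum
      degree agree with the real one.\<close>
    have "m - \<sigma> \<le> 1 * m" by simp
    also have "\<dots> \<le> (l - 1) * m" using assms(3) by (intro mult_le_mono1) simp
    finally have "k * (m - \<sigma>) \<le> k * (l - 1) * m"
      unfolding mult.assoc by (rule mult_le_mono2)
    then have deg: "real (min_degree A) = real k * real (l - 1) * real m - real k * (real m - real \<sigma>)"
      using Gk A lt by simp
    have crit: "critical_chromatic_number H = real (l - 1) * real m / (real m - real \<sigma>)"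
      using assms(3) by (simp add: critical_chromatic_number_def chi sig m_def)
    have order: "real (graph_order A) = real k * real (l - 1) * real m" using Gk A by simp
    have "real (l - 1) \<noteq> 0" "real m \<noteq> 0" "real m - real \<sigma> \<noteq> 0"
      using assms(3) lt by auto
    then have "1 / critical_chromatic_number H * real (graph_order A) = real k * (real m - real \<sigma>)"
      unfolding crit order by (simp del: of_nat_diff)
    then show "real (min_degree A) =
        (1 - 1 / critical_chromatic_number H) * real (graph_order A)"
      unfolding deg left_diff_distrib order by simp
  qed
qed

end
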